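(* Let $\mathcal V=\{V_i\}_{i\in P}$ be a set of views that explains a strongly causal consistent execution. Let $\mathcal R=\{R_i\}_{i\in P}$ be any good record of $\mathcal V$. Then for every process $i\in P$ and any two operations $o^1,o^2\in( *,i,*,* )\cup(\mathrm w,*,*,* )$: if $$(o^1,o^2)\in\widehat{V}_i\setminus\bigl(PO\cup SCO_i(\mathcal V)\cup B_i(\mathcal V)\bigr)$$ (plain set-theoretic union, $\widehat V_i$ the transitive reduction of $V_i$), then $(o^1,o^2)\in R_i$.
   Context: Relations are sets of ordered pairs; $a<_R b$ means $(a,b)\in R$. Partial and total orders are strict (irreflexive, antisymmetric, transitive). $A$ respects $B$ means $B\subseteq A$. $A\mid S$ is the restriction $A\cap(S\times S)$. $\widehat A$ is the (unique) transitive reduction of a partial order $A$ on a finite set. System. There are a finite set $P$ of processes, a finite set $X$ of shared variables and a finite set $O$ of operations. Each operation is a read or a write, performed by one process on one variable. $( *,i,*,* )$ is the set of operations of process $i$, $(\mathrm w,*,*,* )$ the set of all writes, $(\mathrm w,i,*,* )$ the set of writes of process $i$. Put $D_i=( *,i,*,* )\cup(\mathrm w,*,*,* )$. For each $i$ a total order $PO(i)$ on $( *,i,*,* )$ is fixed (independent of the execution), and $PO=\bigcup_i PO(i)$ (program order). Writes write pairwise distinct values. Executions and views. An execution specifies for every read the value it returns: that of some write to the same variable, or the initial default value of the variable. For an execution, a view on $D_i$ is a total order on $D_i$ in which every read returns the value of the last preceding write to the same variable (the default value if there is none). Consequently every family of total orders on the sets $D_i$, $i\in P$, is a family of views for exactly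 one execution. Strong causal order. For $\mathcal V=\{V_i\}_{i\in P}$ with $V_i$ a total order on $D_i$: for a write $w^1$ and a write $w^2$ of process $i$, $(w^1,w^2)\in SCO(\mathcal V)$ iff $(w^1,w^2)\in V_i$. Strong causal consistency. $\mathcal V=\{V_i\}_{i\in P}$ explains a strongly causal consistent execution if for every $i$, $V_i$ is a view on $D_i$ for that execution and $V_i$ respects $SCO(\mathcal V)$ and $PO\mid D_i$. Relations $SCO_i$ and $B_i$. $(w^1,w^2)\in SCO_i(\mathcal V)$ iff $(w^1,w^2)\in SCO(\mathcal V)$ and $w^2$ is a write of some process $j\ne i$. For $w^1\in(\mathrm w,i,*,* )$ and $w^2\in(\mathrm w,j,*,* )$ with $j\neq i$: $(w^1,w^2)\in B_i(\mathcal V)$ iff $(w^1,w^2)\in V_i$ and there is a process $k\notin\{i,j\}$ with $(w^1,w^2)\in V_k$. Records (RnR Model 1). A record of $\mathcal V$ is a family $\mathcal R=\{R_i\}_{i\in P}$ with $R_i\subseteq V_i$. A set of views $\mathcal V'$ certifies a (strongly causal consistent) replay to be valid for $\mathcal R$ if $\mathcal V'$ explains a strongly causal consistent execution and $R_i\subseteq V'_i$ for all $i$. $\mathcal R$ is good if every such $\mathcal V'$ equals $\mathcal V$. *)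

theory Defs
  imports Main
begin

definition strict_total_order :: "'a set \<Rightarrow> 'a rel \<Rightarrow> bool" where
  "strict_total_order D A \<longleftrightarrow> A \<subseteq> D \<times> D \<and> strict_linear_order_on D A"

definition is_transitive_reduction :: "'a rel \<Rightarrow> 'a rel \<Rightarrow> bool" where
  "is_transitive_reduction A B \<longleftrightarrow> B\<^sup>+ = A\<^sup>+ \<and> (\<forall>C. C \<subset> B \<longrightarrow> C\<^sup>+ \<noteq> A\<^sup>+)"

text \<open>
  The definite description is justified, for a finite strict partial order, by
  \<open>transitive_reduction_unique\<close> below.
\<close>

definition transitive_reduction :: "'a rel \<Rightarrow> 'a rel" where
  "transitive_reduction A = (THE B. is_transitive_reduction A B)"

definition covering :: "'a rel \<Rightarrow> 'a rel" where
  "covering A = {(a, b) \<in> A. \<nexists>c. (a, c) \<in> A \<and> (c, b) \<in> A}"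

lemma trancl_covering:
  assumes "finite A" "trans A" "irrefl A"
  shows "(covering A)\<^sup>+ = A"
proof
  have "(covering A)\<^sup>+ \<subseteq> A\<^sup>+"
    by (rule trancl_mono_subset) (auto simp: covering_def)
  then show "(covering A)\<^sup>+ \<subseteq> A"
    using \<open>trans A\<close> by simp
next
  have fin: "finite {c. (a, c) \<in> A \<and> (c, b) \<in> A}" for a b
    by (rule finite_subset[of _ "snd ` A"]) (use \<open>finite A\<close> in force)+
  have "(a, b) \<in> (covering A)\<^sup>+" if "(a, b) \<in> A" for a b
    using that
  proof (induction "card {c. (a, c) \<in> A \<and> (c, b) \<in> A}" arbitrary: a b rule: less_induct)
    case less
    show ?case
    proof (cases "(a, b) \<in> covering A")
      case True
      then show ?thesis by blast
    next
      case False
      then obtain c where c: "(a, c) \<in> A" "(c, b) \<in> A"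
        using less.prems by (auto simp: covering_def)
      have tr: "(x, z) \<in> A" if "(x, y) \<in> A" "(y, z) \<in> A" for x y z
        using transD[OF assms(2)] that .
      have irr: "(c, c) \<notin> A"
        using assms(3) by (simp add: irrefl_def)
      have "{d. (a, d) \<in> A \<and> (d, c) \<in> A} \<subset> {d. (a, d) \<in> A \<and> (d, b) \<in> A}"
        using c irr tr[OF _ c(2)] by blast
      from less.hyps[OF psubset_card_mono[OF fin this] c(1)]
      have ac: "(a, c) \<in> (covering A)\<^sup>+" .
      have "{d. (c, d) \<in> A \<and> (d, b) \<in> A} \<subset> {d. (a, d) \<in> A \<and> (d, b) \<in> A}"
        using c irr tr[OF c(1)] by blast
      from ac less.hyps[OF psubset_card_mono[OF fin this] c(2)]
      show ?thesis by (rule trancl_trans)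
    qed
  qed
  then show "A \<subseteq> (covering A)\<^sup>+" by auto
qed

lemma covering_subset:
  assumes "trans A" "B\<^sup>+ = A"
  shows "covering A \<subseteq> B"
proof clarify
  fix a b assume ab: "(a, b) \<in> covering A"
  then have "(a, b) \<in> B\<^sup>+" using assms by (auto simp: covering_def)
  then show "(a, b) \<in> B"
  proof (cases rule: tranclE)
    case (step c)
    then have "(a, c) \<in> A" "(c, b) \<in> A" using assms by auto
    then show ?thesis using ab by (auto simp: covering_def)
  qed
qed

lemma is_transitive_reduction_iff:
  assumes "finite A" "trans A" "irrefl A"
  shows "is_transitive_reduction A B \<longleftrightarrow> B = covering A"
proof -
  have A: "A\<^sup>+ = A" using assms by simp
  note cov = trancl_covering[OF assms] covering_subset[OF assms(2)]
  show ?thesis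
  proof
    assume "is_transitive_reduction A B"
    then show "B = covering A"
      using cov unfolding is_transitive_reduction_def A by blast
  next
    assume "B = covering A"
    then show "is_transitive_reduction A B"
      using cov unfolding is_transitive_reduction_def A by blast
  qed
qed

lemma transitive_reduction_unique:
  assumes "finite A" "trans A" "irrefl A"
  shows "\<exists>!B. is_transitive_reduction A B"
  using is_transitive_reduction_iff[OF assms] by auto

lemma transitive_reduction_eq_covering:
  assumes "finite A" "trans A" "irrefl A"
  shows "transitive_reduction A = covering A"
  using is_transitive_reduction_iff[OF assms] by (simp add: transitive_reduction_def)

text \<open>
  \<open>written\<close> is meaningful on writes only, and \<open>prog i\<close> is the program order of process \<open>i\<close>.
\<close>

record ('p, 'x, 'o, 'v) system =
  procs :: "'p set"
  vars :: "'x set"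
  opers :: "'o set"
  is_write :: "'o \<Rightarrow> bool"
  proc :: "'o \<Rightarrow> 'p"
  var :: "'o \<Rightarrow> 'x"
  written :: "'o \<Rightarrow> 'v"
  initial :: "'x \<Rightarrow> 'v"
  prog :: "'p \<Rightarrow> 'o rel"

definition opers_of :: "('p, 'x, 'o, 'v) system \<Rightarrow> 'p \<Rightarrow> 'o set" where
  "opers_of S i = {a \<in> opers S. proc S a = i}"

definition writes :: "('p, 'x, 'o, 'v) system \<Rightarrow> 'o set" where
  "writes S = {a \<in> opers S. is_write S a}"

definition reads :: "('p, 'x, 'o, 'v) system \<Rightarrow> 'o set" where
  "reads S = {a \<in> opers S. \<not> is_write S a}"

definition writes_of :: "('p, 'x, 'o, 'v) system \<Rightarrow> 'p \<Rightarrow> 'o set" where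
  "writes_of S i = writes S \<inter> opers_of S i"

definition view_dom :: "('p, 'x, 'o, 'v) system \<Rightarrow> 'p \<Rightarrow> 'o set" where
  "view_dom S i = opers_of S i \<union> writes S"

definition PO :: "('p, 'x, 'o, 'v) system \<Rightarrow> 'o rel" where
  "PO S = (\<Union>i\<in>procs S. prog S i)"

definition wf_system :: "('p, 'x, 'o, 'v) system \<Rightarrow> bool" where
  "wf_system S \<longleftrightarrow>
     finite (procs S) \<and> finite (vars S) \<and> finite (opers S) \<and>
     (\<forall>a\<in>opers S. proc S a \<in> procs S \<and> var S a \<in> vars S) \<and>
     inj_on (written S) (writes S) \<and>
     (\<forall>i\<in>procs S. strict_total_order (opers_of S i) (prog S i))"

text \<open>
  An execution is a function giving the value returned by each read; its values at other
  arguments are irrelevant.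
\<close>

definition is_execution :: "('p, 'x, 'o, 'v) system \<Rightarrow> ('o \<Rightarrow> 'v) \<Rightarrow> bool" where
  "is_execution S E \<longleftrightarrow>
     (\<forall>r\<in>reads S. E r \<in> insert (initial S (var S r))
                            (written S ` {w \<in> writes S. var S w = var S r}))"

definition preceding_writes :: "('p, 'x, 'o, 'v) system \<Rightarrow> 'o rel \<Rightarrow> 'o \<Rightarrow> 'o set" where
  "preceding_writes S A r = {w \<in> writes S. var S w = var S r \<and> (w, r) \<in> A}"

definition is_last_write :: "('p, 'x, 'o, 'v) system \<Rightarrow> 'o rel \<Rightarrow> 'o \<Rightarrow> 'o \<Rightarrow> bool" where
  "is_last_write S A r w \<longleftrightarrow>
     w \<in> preceding_writes S A r \<and> (\<forall>w'\<in>preceding_writes S A r. w' = w \<or> (w', w) \<in> A)"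

definition is_view :: "('p, 'x, 'o, 'v) system \<Rightarrow> ('o \<Rightarrow> 'v) \<Rightarrow> 'p \<Rightarrow> 'o rel \<Rightarrow> bool" where
  "is_view S E i A \<longleftrightarrow>
     strict_total_order (view_dom S i) A \<and>
     (\<forall>r \<in> view_dom S i \<inter> reads S.
        (preceding_writes S A r = {} \<longrightarrow> E r = initial S (var S r)) \<and>
        (\<forall>w. is_last_write S A r w \<longrightarrow> E r = written S w))"

text \<open>
  Families indexed by processes are functions whose values outside \<open>procs S\<close> are irrelevant.
\<close>

definition SCO :: "('p, 'x, 'o, 'v) system \<Rightarrow> ('p \<Rightarrow> 'o rel) \<Rightarrow> 'o rel" where
  "SCO S V = {(w1, w2). \<exists>i\<in>procs S. w1 \<in> writes S \<and> w2 \<in> writes_of S i \<and> (w1, w2) \<in> V i}"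

definition explains ::
  "('p, 'x, 'o, 'v) system \<Rightarrow> ('p \<Rightarrow> 'o rel) \<Rightarrow> ('o \<Rightarrow> 'v) \<Rightarrow> bool" where
  "explains S V E \<longleftrightarrow>
     is_execution S E \<and>
     (\<forall>i\<in>procs S. is_view S E i (V i) \<and> SCO S V \<subseteq> V i \<and> Restr (PO S) (view_dom S i) \<subseteq> V i)"

definition SCO_of ::
  "('p, 'x, 'o, 'v) system \<Rightarrow> ('p \<Rightarrow> 'o rel) \<Rightarrow> 'p \<Rightarrow> 'o rel" where
  "SCO_of S V i = {(w1, w2) \<in> SCO S V. \<exists>j\<in>procs S. j \<noteq> i \<and> w2 \<in> writes_of S j}"

definition B_of ::
  "('p, 'x, 'o, 'v) system \<Rightarrow> ('p \<Rightarrow> 'o rel) \<Rightarrow> 'p \<Rightarrow> 'o rel" where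
  "B_of S V i = {(w1, w2). \<exists>j\<in>procs S. j \<noteq> i \<and> w1 \<in> writes_of S i \<and> w2 \<in> writes_of S j \<and>
                   (w1, w2) \<in> V i \<and> (\<exists>k \<in> procs S - {i, j}. (w1, w2) \<in> V k)}"

definition is_record ::
  "('p, 'x, 'o, 'v) system \<Rightarrow> ('p \<Rightarrow> 'o rel) \<Rightarrow> ('p \<Rightarrow> 'o rel) \<Rightarrow> bool" where
  "is_record S V R \<longleftrightarrow> (\<forall>i\<in>procs S. R i \<subseteq> V i)"

text \<open>The replayed execution may differ from the recorded one.\<close>

definition certifies ::
  "('p, 'x, 'o, 'v) system \<Rightarrow> ('p \<Rightarrow> 'o rel) \<Rightarrow> ('p \<Rightarrow> 'o rel) \<Rightarrow> bool" where
  "certifies S R V' \<longleftrightarrow> (\<exists>E. explains S V' E) \<and> (\<forall>i\<in>procs S. R i \<subseteq> V' i)"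

definition good_record ::
  "('p, 'x, 'o, 'v) system \<Rightarrow> ('p \<Rightarrow> 'o rel) \<Rightarrow> ('p \<Rightarrow> 'o rel) \<Rightarrow> bool" where
  "good_record S V R \<longleftrightarrow>
     is_record S V R \<and> (\<forall>V'. certifies S R V' \<longrightarrow> (\<forall>i\<in>procs S. V' i = V i))"

lemma ex_last_write:
  assumes "wf_system S" "strict_total_order (view_dom S i) A" "preceding_writes S A r \<noteq> {}"
  shows "\<exists>!w. is_last_write S A r w"
proof -
  let ?W = "preceding_writes S A r"
  have A: "trans A" "irrefl A" "total_on (view_dom S i) A"
    using assms(2) by (auto simp: strict_total_order_def strict_linear_order_on_def)
  have sub: "?W \<subseteq> view_dom S i" by (auto simp: preceding_writes_def view_dom_def)
  have "finite ?W"
    using assms(1) by (auto simp: preceding_writes_def writes_def wf_system_def)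
  moreover have "\<exists>w\<in>F. \<forall>w'\<in>F. w' = w \<or> (w', w) \<in> A"
    if "finite F" "F \<noteq> {}" "F \<subseteq> view_dom S i" for F
    using that
  proof (induction rule: finite_ne_induct)
    case (singleton x)
    then show ?case by simp
  next
    case (insert x F)
    then obtain w where w: "w \<in> F" "\<forall>w'\<in>F. w' = w \<or> (w', w) \<in> A" by auto
    then have "x \<noteq> w" "x \<in> view_dom S i" "w \<in> view_dom S i" using insert by auto
    then have "(x, w) \<in> A \<or> (w, x) \<in> A" using A(3) by (auto simp: total_on_def)
    then show ?case
    proof
      assume "(x, w) \<in> A"
      then show ?thesis using w by auto
    next
      assume wx: "(w, x) \<in> A"
      have "(w', x) \<in> A" if "w' \<in> F" for w'
        using w(2) that wx transD[OF A(1) _ wx] by auto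
      then show ?thesis by auto
    qed
  qed
  ultimately have "\<exists>w\<in>?W. \<forall>w'\<in>?W. w' = w \<or> (w', w) \<in> A"
    using assms(3) sub by blast
  then obtain w where "is_last_write S A r w"
    unfolding is_last_write_def by blast
  moreover have "w' = w''" if "is_last_write S A r w'" "is_last_write S A r w''" for w' w''
  proof (rule ccontr)
    assume "w' \<noteq> w''"
    then have "(w', w'') \<in> A" "(w'', w') \<in> A"
      using that unfolding is_last_write_def by auto
    then have "(w', w') \<in> A" by (rule transD[OF A(1)])
    then show False using A(2) by (simp add: irrefl_def)
  qed
  ultimately show ?thesis by blast
qed

lemma views_determine_execution:
  assumes wf: "wf_system S"
    and ord: "\<And>i. i \<in> procs S \<Longrightarrow> strict_total_order (view_dom S i) (V i)"
  shows "\<exists>E. is_execution S E \<and> (\<forall>i\<in>procs S. is_view S E i (V i))" (is ?ex)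
    and "\<lbrakk>\<forall>i\<in>procs S. is_view S E i (V i); \<forall>i\<in>procs S. is_view S E' i (V i); r \<in> reads S\<rbrakk>
           \<Longrightarrow> E r = E' r"
proof -
  have own: "proc S r \<in> procs S" "r \<in> view_dom S (proc S r)" if "r \<in> reads S" for r
    using that wf by (auto simp: reads_def wf_system_def view_dom_def opers_of_def)
  have only: "i = proc S r" if "r \<in> view_dom S i" "r \<in> reads S" for i r
    using that by (auto simp: reads_def writes_def view_dom_def opers_of_def)
  define E0 where "E0 r = (let A = V (proc S r) in
    if preceding_writes S A r = {} then initial S (var S r)
    else written S (THE w. is_last_write S A r w))" for r
  have E0_last: "E0 r = written S w" if "r \<in> reads S" "is_last_write S (V (proc S r)) r w" for r w
  proof -
    have ne: "preceding_writes S (V (proc S r)) r \<noteq> {}"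
      using that(2) by (auto simp: is_last_write_def)
    have "(THE w. is_last_write S (V (proc S r)) r w) = w"
      using ex_last_write[OF wf ord[OF own(1)[OF that(1)]] ne] that(2) by (blast intro: the1_equality)
    then show ?thesis using ne by (simp add: E0_def Let_def)
  qed
  have E0_view: "is_view S E0 i (V i)" if "i \<in> procs S" for i
    using ord[OF that] E0_last only unfolding is_view_def by (auto simp: E0_def)
  have "is_execution S E0"
    unfolding is_execution_def
  proof
    fix r assume r: "r \<in> reads S"
    show "E0 r \<in> insert (initial S (var S r)) (written S ` {w \<in> writes S. var S w = var S r})"
    proof (cases "preceding_writes S (V (proc S r)) r = {}")
      case True
      then show ?thesis by (simp add: E0_def)
    next
      case False
      then obtain w where w: "is_last_write S (V (proc S r)) r w"
        using ex_last_write[OF wf ord[OF own(1)[OF r]]] by blast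
      then show ?thesis
        using E0_last[OF r w] by (auto simp: is_last_write_def preceding_writes_def)
    qed
  qed
  then show ?ex using E0_view by blast
  show "E r = E' r" if views: "\<forall>i\<in>procs S. is_view S E i (V i)" "\<forall>i\<in>procs S. is_view S E' i (V i)"
    and r: "r \<in> reads S"
  proof (cases "preceding_writes S (V (proc S r)) r = {}")
    case True
    then show ?thesis using views r own[OF r] unfolding is_view_def by auto
  next
    case False
    then obtain w where "is_last_write S (V (proc S r)) r w"
      using ex_last_write[OF wf ord[OF own(1)[OF r]]] by blast
    then show ?thesis using views r own[OF r] unfolding is_view_def by auto
  qed
qed

end

(*
  If a covering pair (o1, o2) of V_i were not recorded, swapping o1 and o2 in V_i alone would still
  give a certifying family different from V. The swap keeps V_i a total order because the pair is
  covering, and breaks no constraint on V_i because the pair lies outside PO and SCO_i. The other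
  views are only affected if o1 is a write of i and o2 a write of some j \<noteq> i, when the swap adds
  (o2, o1) to the strong causal order; but all of them already contain (o2, o1): V_j because the
  pair is not in SCO_i, the remaining ones because it is not in B_i.
*)
theory Submission
  imports Defs
begin

definition swap_pair :: "'a \<Rightarrow> 'a \<Rightarrow> 'a rel \<Rightarrow> 'a rel" where
  "swap_pair a b A = insert (b, a) (A - {(a, b)})"

text \<open>Nothing lies strictly between \<open>a\<close> and \<open>b\<close>, so every other
  element is on the same side of both, and reversing this one pair cannot disturb
  transitivity.\<close>

lemma strict_total_order_swap_pair:
  assumes A: "strict_total_order D A" and ab: "(a, b) \<in> covering A"
  shows "strict_total_order D (swap_pair a b A)"
proof -
  have tr: "trans A" and ir: "irrefl A" and tot: "total_on D A" and sub: "A \<subseteq> D \<times> D"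
    using A by (auto simp: strict_total_order_def strict_linear_order_on_def)
  have abA: "(a, b) \<in> A" and nc: "\<And>c. (a, c) \<in> A \<Longrightarrow> (c, b) \<notin> A"
    using ab by (auto simp: covering_def)
  have nirr: "(x, x) \<notin> A" for x
    using ir by (simp add: irrefl_def)
  have D: "a \<in> D" "b \<in> D" and "a \<noteq> b"
    using abA sub nirr by auto
  \<comment> \<open>A chain through the new pair \<open>(b, a)\<close> ends with some
    \<open>(a, z)\<close> or starts with some \<open>(x, b)\<close>. By totality, failure of the
    required conclusion would put \<open>z\<close> or \<open>x\<close> between \<open>a\<close> and
    \<open>b\<close>.\<close>
  have after_b: "(b, z) \<in> A" if "(a, z) \<in> A" "z \<noteq> b" for z
    using tot that nc[OF that(1)] D sub unfolding total_on_def by blast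
  have before_a: "(x, a) \<in> A" if "(x, b) \<in> A" "x \<noteq> a" for x
    using tot that nc[of x] D sub unfolding total_on_def by blast
  have "trans (swap_pair a b A)"
  proof (rule transI)
    fix x y z
    assume "(x, y) \<in> swap_pair a b A" "(y, z) \<in> swap_pair a b A"
    \<comment> \<open>Two old pairs cannot compose to the removed \<open>(a, b)\<close>:
      \<open>nc\<close> excludes the middle element \<open>y\<close>.\<close>
    then show "(x, z) \<in> swap_pair a b A"
      using after_b before_a transD[OF tr, of x y z] nc[of y] \<open>a \<noteq> b\<close>
      unfolding swap_pair_def by blast
  qed
  moreover have "irrefl (swap_pair a b A)"
    using nirr \<open>a \<noteq> b\<close> by (auto simp: irrefl_def swap_pair_def)
  moreover have "total_on D (swap_pair a b A)"
    using tot by (auto simp: total_on_def swap_pair_def)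
  moreover have "swap_pair a b A \<subseteq> D \<times> D"
    using sub D by (auto simp: swap_pair_def)
  ultimately show ?thesis
    by (simp add: strict_total_order_def strict_linear_order_on_def)
qed

theorem theorem5p4:
  fixes S :: "('p, 'x, 'o, 'v) system"
    and V R :: "'p \<Rightarrow> 'o rel"
    and E :: "'o \<Rightarrow> 'v"
  assumes "wf_system S"
    and "explains S V E"
    and "good_record S V R"
    and "i \<in> procs S"
    and "o1 \<in> view_dom S i" and "o2 \<in> view_dom S i"
    and "(o1, o2) \<in> transitive_reduction (V i) - (PO S \<union> SCO_of S V i \<union> B_of S V i)"
  shows "(o1, o2) \<in> R i"
proof (rule ccontr)
  assume notR: "(o1, o2) \<notin> R i"
  note i = \<open>i \<in> procs S\<close>
  have ord: "strict_total_order (view_dom S k) (V k)"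
    and sco: "SCO S V \<subseteq> V k" and po: "Restr (PO S) (view_dom S k) \<subseteq> V k"
    if "k \<in> procs S" for k
    using assms(2) that by (auto simp: explains_def is_view_def)
  have tr: "trans (V i)" and ir: "irrefl (V i)" and sub: "V i \<subseteq> view_dom S i \<times> view_dom S i"
    using ord[OF i] by (auto simp: strict_total_order_def strict_linear_order_on_def)
  have "finite (view_dom S i)"
    using assms(1) by (auto simp: wf_system_def view_dom_def opers_of_def writes_def)
  then have "finite (V i)"
    using sub finite_subset by blast
  then have cov: "(o1, o2) \<in> covering (V i)"
    using assms(7) transitive_reduction_eq_covering[OF _ tr ir] by simp
  then have in_Vi: "(o1, o2) \<in> V i"
    by (simp add: covering_def)
  have ne: "o1 \<noteq> o2"
    using in_Vi ir by (auto simp: irrefl_def)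
  have rev_notin: "(o2, o1) \<notin> V i"
    using in_Vi transD[OF tr, of o1 o2 o1] ir by (auto simp: irrefl_def)
  have notPO: "(o1, o2) \<notin> PO S" and notSCO: "(o1, o2) \<notin> SCO_of S V i"
    and notB: "(o1, o2) \<notin> B_of S V i"
    using assms(7) by auto
  define V' where "V' = V(i := swap_pair o1 o2 (V i))"
  have ord': "strict_total_order (view_dom S k) (V' k)" if "k \<in> procs S" for k
    using ord[OF that] strict_total_order_swap_pair[OF ord[OF i] cov] by (simp add: V'_def)
  have others: "(o2, o1) \<in> V k"
    if o1: "o1 \<in> writes_of S i" and o2: "o2 \<in> writes S" and k: "k \<in> procs S" "k \<noteq> i" for k
  proof -
    define j where "j = proc S o2"
    have j: "j \<in> procs S" "o2 \<in> writes_of S j"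
      using o2 assms(1) by (auto simp: j_def wf_system_def writes_def writes_of_def opers_of_def)
    \<comment> \<open>Two operations of process \<open>i\<close> are ordered by
      \<open>prog S i\<close>. As \<open>(o1, o2)\<close> is not in \<open>PO S\<close>, the reverse
      pair would be, and \<open>V i\<close> would contain both directions.\<close>
    have "j \<noteq> i"
    proof
      assume "j = i"
      then have mem: "o1 \<in> opers_of S i" "o2 \<in> opers_of S i"
        using o1 j(2) by (auto simp: writes_of_def)
      have "total_on (opers_of S i) (prog S i)"
        using assms(1) i
        by (auto simp: wf_system_def strict_total_order_def strict_linear_order_on_def)
      then have "(o1, o2) \<in> prog S i \<or> (o2, o1) \<in> prog S i"
        using mem ne by (auto simp: total_on_def)
      then have "(o2, o1) \<in> PO S"
        using notPO i by (auto simp: PO_def)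
      then show False
        using po[OF i] assms(5,6) rev_notin by blast
    qed
    \<comment> \<open>If \<open>k = j\<close>, membership would put the pair into
      \<open>SCO_of S V i\<close>; otherwise \<open>k\<close> would be the third process witnessing
      \<open>B_of S V i\<close>.\<close>
    have "(o1, o2) \<notin> V k"
    proof (cases "k = j")
      case True
      then show ?thesis
        using notSCO o1 j \<open>j \<noteq> i\<close> by (auto simp: SCO_of_def SCO_def writes_of_def)
    next
      case False
      then show ?thesis
        using notB o1 j \<open>j \<noteq> i\<close> k in_Vi unfolding B_of_def by blast
    qed
    moreover have "o1 \<in> view_dom S k" "o2 \<in> view_dom S k"
      using o1 o2 by (auto simp: writes_of_def view_dom_def)
    ultimately show ?thesis
      using ord[OF k(1)] ne
      by (auto simp: strict_total_order_def strict_linear_order_on_def total_on_def)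
  qed
  have sco': "SCO S V' \<subseteq> V' k" if k: "k \<in> procs S" for k
  proof clarify
    fix w1 w2 assume "(w1, w2) \<in> SCO S V'"
    then obtain l where l: "l \<in> procs S" "w1 \<in> writes S" "w2 \<in> writes_of S l" "(w1, w2) \<in> V' l"
      by (auto simp: SCO_def)
    show "(w1, w2) \<in> V' k"
    proof (cases "(w1, w2) \<in> V l")
      case True
      then have s: "(w1, w2) \<in> SCO S V"
        using l by (auto simp: SCO_def)
      show ?thesis
      proof (cases "k = i")
        case True
        show ?thesis
        proof (cases "l = i")
          case True
          then show ?thesis using l(4) \<open>k = i\<close> by simp
        next
          case False
          \<comment> \<open>An old pair ending in a write of \<open>l \<noteq> i\<close> belongs to
            \<open>SCO_of S V i\<close>, so it is not the pair that the swap removes.\<close>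
          then have "(w1, w2) \<noteq> (o1, o2)"
            using notSCO s l by (auto simp: SCO_of_def)
          then show ?thesis
            using s sco[OF i] \<open>k = i\<close> by (auto simp: V'_def swap_pair_def)
        qed
      next
        case False
        then show ?thesis using s sco[OF k] by (auto simp: V'_def)
      qed
    next
      case False
      \<comment> \<open>The only strong causal pair that can be new is \<open>(o2, o1)\<close>, seen
        through \<open>V' i\<close>; then \<open>o1\<close> is a write of \<open>i\<close> and
        \<open>o2\<close> is a write, as \<open>others\<close> requires.\<close>
      then have "l = i" "w1 = o2" "w2 = o1"
        using l(4) by (auto simp: V'_def swap_pair_def split: if_splits)
      then show ?thesis
        using l others k by (cases "k = i") (auto simp: V'_def swap_pair_def)
    qed
  qed
  have po': "Restr (PO S) (view_dom S k) \<subseteq> V' k" if "k \<in> procs S" for k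
    using po[OF that] notPO by (auto simp: V'_def swap_pair_def)
  \<comment> \<open>The swap may change the value of a read, so \<open>E\<close> need not fit
    \<open>V'\<close>. Validity of a replay allows any execution, and total orders always determine
    one.\<close>
  obtain E' where "explains S V' E'"
    using views_determine_execution(1)[OF assms(1) ord'] sco' po' unfolding explains_def by blast
  moreover have "R k \<subseteq> V' k" if "k \<in> procs S" for k
    using assms(3) that notR by (auto simp: good_record_def is_record_def V'_def swap_pair_def)
  ultimately have "V' i = V i"
    using assms(3) i unfolding good_record_def certifies_def by blast
  then show False
    using rev_notin by (auto simp: V'_def swap_pair_def)
qed

end
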